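(* Let $\omega$ be the set of non-negative integers and let $E = \{A\subseteq \omega : \omega \setminus A \text{ is finite}\}$. Then: (1) for every finite subset $E_0\subseteq E$, the hypergraph $(\omega, E_0)$ satisfies König's Property; but (2) the hypergraph $(\omega, E)$ does not satisfy König's Property.
   Context: A hypergraph is a pair $H=(V,E)$ where $V$ is a set and $E$ is a set of non-empty subsets of $V$, called edges. A (vertex) cover of $H$ is a set $C\subseteq V$ such that $C\cap e\neq\emptyset$ for all $e\in E$. A matching is a set $M\subseteq E$ of pairwise disjoint edges (possibly empty). $H$ has König's Property if there are a matching $M_0\subseteq E$ and a cover $C_0\subseteq V$ of $H$ such that $|C_0\cap e| = 1$ for all $e\in M_0$ and $C_0\subseteq \bigcup M_0$ (that is, $C_0$ consists of the choice of precisely one vertex from each edge of $M_0$). *)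

theory Defs
  imports Main
begin

type_synonym 'a hypergraph_pair = "'a set \<times> 'a set set"

definition hypergraph :: "'a hypergraph_pair \<Rightarrow> bool" where
  "hypergraph H \<longleftrightarrow> (case H of (V, E) \<Rightarrow> (\<forall>e\<in>E. e \<subseteq> V \<and> e \<noteq> {}))"

definition vertex_cover :: "'a hypergraph_pair \<Rightarrow> 'a set \<Rightarrow> bool" where
  "vertex_cover H C \<longleftrightarrow> (case H of (V, E) \<Rightarrow> C \<subseteq> V \<and> (\<forall>e\<in>E. C \<inter> e \<noteq> {}))"

definition matching :: "'a hypergraph_pair \<Rightarrow> 'a set set \<Rightarrow> bool" where
  "matching H M \<longleftrightarrow> (case H of (V, E) \<Rightarrow>
     M \<subseteq> E \<and> (\<forall>e\<in>M. \<forall>f\<in>M. e \<noteq> f \<longrightarrow> e \<inter> f = {}))"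

text \<open>Since \<open>card\<close> is 0 on infinite sets, \<open>card (C \<inter> e) = 1\<close> does say that
  \<open>C \<inter> e\<close> is a singleton, also for infinite edges \<open>e\<close>.\<close>

definition koenig_property :: "'a hypergraph_pair \<Rightarrow> bool" where
  "koenig_property H \<longleftrightarrow>
     (\<exists>M C. matching H M \<and> vertex_cover H C \<and>
        (\<forall>e\<in>M. card (C \<inter> e) = 1) \<and> C \<subseteq> \<Union>M)"

end

theory Submission
  imports Defs
begin

text \<open>Finitely many cofinite sets share a point, and that point alone is a cover. On the other hand
  any two cofinite sets meet, so a matching of cofinite sets has at most one edge and the cover it
  would carry is finite; the complement of that cover is an edge that it misses.\<close>

text \<open>Any single edge \<open>e\<close> gives the matching \<open>{e}\<close> with cover
  \<open>{x}\<close>. Without edges the only matching is empty, which forces the empty cover; hence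
  the case split.\<close>

lemma koenig_property_common_vertex:
  assumes "x \<in> V" and "\<And>e. e \<in> E \<Longrightarrow> x \<in> e"
  shows "koenig_property (V, E)"
proof (cases "E = {}")
  case True
  then show ?thesis
    by (auto simp: koenig_property_def matching_def vertex_cover_def)
next
  case False
  then obtain e where e: "e \<in> E" by blast
  have "{x} \<inter> e = {x}" using assms(2)[OF e] by blast
  then have "matching (V, E) {e} \<and> vertex_cover (V, E) {x} \<and>
      (\<forall>f\<in>{e}. card ({x} \<inter> f) = 1) \<and> {x} \<subseteq> \<Union>{e}"
    using e assms by (auto simp: matching_def vertex_cover_def)
  then show ?thesis
    unfolding koenig_property_def by blast
qed

text \<open>By De Morgan, an empty intersection would make \<open>UNIV\<close> a finite union of
  finite complements. The case \<open>F = {}\<close> is included, since then the intersection is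
  \<open>UNIV\<close>.\<close>

lemma cofinite_Inter_nonempty:
  fixes F :: "'a set set"
  assumes "infinite (UNIV :: 'a set)" and "finite F" and "\<And>A. A \<in> F \<Longrightarrow> finite (- A)"
  shows "\<Inter>F \<noteq> {}"
proof
  assume "\<Inter>F = {}"
  then have "(UNIV :: 'a set) = (\<Union>A\<in>F. - A)" by blast
  moreover have "finite (\<Union>A\<in>F. - A)" using assms(2,3) by blast
  ultimately show False using assms(1) by simp
qed

lemma not_koenig_property_cofinite:
  assumes inf: "infinite (UNIV :: 'a set)"
  shows "\<not> koenig_property (UNIV, {A :: 'a set. finite (- A)})"
proof
  assume "koenig_property (UNIV, {A :: 'a set. finite (- A)})"
  then obtain M and C :: "'a set" where
      M: "matching (UNIV, {A. finite (- A)}) M"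
    and C: "vertex_cover (UNIV, {A. finite (- A)}) C"
    and one: "\<forall>e\<in>M. card (C \<inter> e) = 1"
    and sub: "C \<subseteq> \<Union>M"
    unfolding koenig_property_def by blast
  have cofin: "finite (- e)" if "e \<in> M" for e
    using M that by (auto simp: matching_def)
  have disj: "e \<inter> f = {}" if "e \<in> M" "f \<in> M" "e \<noteq> f" for e f
    using M that by (auto simp: matching_def)
  have cover: "C \<inter> e \<noteq> {}" if "finite (- e)" for e
    using C that by (simp add: vertex_cover_def)
  \<comment> \<open>Distinct edges of \<open>M\<close> would be disjoint, but two cofinite sets
    always meet.\<close>
  have unique: "e = f" if "e \<in> M" "f \<in> M" for e f
    using cofinite_Inter_nonempty[OF inf, of "{e, f}"] cofin disj that by auto
  have "finite C"
  proof (cases "M = {}")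
    case True
    then show ?thesis using sub by simp
  next
    case False
    then obtain e where "e \<in> M" by blast
    \<comment> \<open>Here \<open>e\<close> is the only edge of \<open>M\<close>, so
      \<open>C\<close> lies inside it. As \<open>card\<close> is 0 on infinite sets, cardinality 1
      then makes \<open>C\<close> finite.\<close>
    then have "C \<inter> e = C" using unique sub by blast
    then show ?thesis using one \<open>e \<in> M\<close> by (metis card.infinite zero_neq_one)
  qed
  then show False using cover[of "- C"] by simp
qed

theorem proposition3p1:
  fixes \<omega> :: "nat set" and E :: "nat set set"
  assumes "\<omega> = UNIV"
    and "E = {A. A \<subseteq> \<omega> \<and> finite (\<omega> - A)}"
  shows "(\<forall>E\<^sub>0. E\<^sub>0 \<subseteq> E \<and> finite E\<^sub>0 \<longrightarrow>
            hypergraph (\<omega>, E\<^sub>0) \<and> koenig_property (\<omega>, E\<^sub>0)) \<and>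
         (hypergraph (\<omega>, E) \<and> \<not> koenig_property (\<omega>, E))"
proof -
  have E: "E = {A. finite (- A)}"
    using assms by (simp add: Compl_eq_Diff_UNIV)
  \<comment> \<open>The complement of the empty set is all of \<open>nat\<close>, which is infinite;
    so edges are non-empty, as \<open>hypergraph\<close> demands.\<close>
  have "{} \<notin> E" by (simp add: E)
  then have hyp: "hypergraph (\<omega>, F)" if "F \<subseteq> E" for F
    using that assms(1) by (auto simp: hypergraph_def)
  have "koenig_property (\<omega>, F)" if F: "F \<subseteq> E" "finite F" for F
  proof -
    have "\<Inter>F \<noteq> {}"
      using cofinite_Inter_nonempty[OF infinite_UNIV_nat F(2)] F(1) E by blast
    then obtain x where "x \<in> \<Inter>F" by blast
    then show ?thesis
      using assms(1) by (intro koenig_property_common_vertex[of x]) auto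
  qed
  moreover have "\<not> koenig_property (\<omega>, E)"
    using not_koenig_property_cofinite[OF infinite_UNIV_nat] by (simp add: assms(1) E)
  ultimately show ?thesis using hyp by blast
qed

end
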